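(* Let $G$ be a graph formed by taking a finite subset of the unit $d$-dimensional cells comprising $T^d_\infty$. Let $G^n$ be the graph obtained by replacing each unit cell by a cell of length $n$ divided regularly into $n^d$ unit cells. Let $S$ be a finite multiset of $d$-dimensional figures, and let $f_S(n)$ be the number of ways to place all of the figures in $S$ on $G^n$ such that none overlap. Then there exist a positive integer $n_0$ and an integer polynomial $p(x)$ such that $f_S(n)=p(n)$ for all $n\ge n_0$.
   Context: $T^d_\infty$ is the infinite grid graph with vertex set $\mathbb{Z}^d$, two vertices being adjacent iff they differ by $\pm$ a standard basis vector. A unit $d$-dimensional cell is a cube $z+[0,1]^d$ with $z\in\mathbb{Z}^d$; the graph formed from a finite set $Z$ of such cells consists of the vertices and edges of $T^d_\infty$ contained in these cells. $G^n$ then consists of the vertices and edges of $T^d_\infty$ contained in the scaled cells $nz+[0,n]^d$, over all cells $z+[0,1]^d$ in $Z$. A $d$-dimensional figure is a finite subset of $\mathbb{Z}^d$, up to translation by integer vectors. A placement of a figure on $G^n$ is a set of vertices of $G^n$ that, as a subset of $\mathbb{Z}^d$, represents the figure. Two placed figures overlap if they share a vertex. Repeated copies of the same figure in the multiset $S$ are indistinguishable.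
   Formalization: "Integer polynomial" is read as integer-valued polynomial with rational coefficients; with integer coefficients the claim fails, e.g. d=1, one cell, S two indistinguishable copies of a single vertex gives f_S(n)=n(n+1)/2. *)

theory Defs
  imports
    "HOL-Analysis.Analysis"
    "HOL-Computational_Algebra.Polynomial"
    "HOL-Library.Multiset"
begin

(* A simple graph is a pair of a vertex set and a set of edges, edges being two-element vertex
   sets.  The dimension d is CARD('d). *)

type_synonym 'a graph = "'a set \<times> 'a set set"

abbreviation vertices :: "'a graph \<Rightarrow> 'a set" where
  "vertices G \<equiv> fst G"

abbreviation edges :: "'a graph \<Rightarrow> 'a set set" where
  "edges G \<equiv> snd G"

definition infinite_grid :: "(int ^ 'd) graph" where
  "infinite_grid = (UNIV, {{v, v + axis i 1} | v i. True})"

definition real_point :: "int ^ 'd \<Rightarrow> real ^ 'd" where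
  "real_point v = (\<chi> i. real_of_int (v $ i))"

(* The cube n z + [0,n]^d; for n = 1 it is the unit cell with lowest corner z. *)
definition scaled_cell :: "nat \<Rightarrow> int ^ 'd \<Rightarrow> (real ^ 'd) set" where
  "scaled_cell n z =
     cbox (real n *\<^sub>R real_point z) (real n *\<^sub>R real_point z + vec (real n))"

(* A finite collection of unit cells is given by the set Z of their lowest corners.  The graph G
   is cell_graph Z 1, and G^n is cell_graph Z n.  Note that G^n is determined by the chosen cells
   and not by G alone: different sets of cells can give the same graph G.  The convex hull of an
   edge of the grid is the line segment joining its end points. *)
definition cell_graph :: "(int ^ 'd) set \<Rightarrow> nat \<Rightarrow> (int ^ 'd) graph" where
  "cell_graph Z n =
     ({v \<in> vertices infinite_grid. \<exists>z\<in>Z. real_point v \<in> scaled_cell n z},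
      {e \<in> edges infinite_grid. \<exists>z\<in>Z. convex hull (real_point ` e) \<subseteq> scaled_cell n z})"

definition translation_rel :: "((int ^ 'd) set \<times> (int ^ 'd) set) set" where
  "translation_rel = {(A, B). finite A \<and> finite B \<and> (\<exists>t. B = (\<lambda>v. t + v) ` A)}"

definition figures :: "(int ^ 'd) set set set" where
  "figures = {A. finite A} // translation_rel"

definition placements :: "(int ^ 'd) set set \<Rightarrow> (int ^ 'd) graph \<Rightarrow> (int ^ 'd) set set" where
  "placements F G = {A. A \<subseteq> vertices G \<and> A \<in> F}"

(* Every member of S, with multiplicity, is matched with one of its placements.  The outcome is
   the multiset of the placed vertex sets, so that permuting copies of the same figure gives
   nothing new; distinct figures stay distinguishable because a vertex set represents only one
   figure.  The last condition says that any two placed figures (at different positions of the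
   multiset P) share no vertex. *)
definition packings :: "(int ^ 'd) set set multiset \<Rightarrow> (int ^ 'd) graph \<Rightarrow>
    (int ^ 'd) set multiset set" where
  "packings S G =
     {P. rel_mset (\<lambda>F A. A \<in> placements F G) S P \<and>
         (\<forall>A B. {#A, B#} \<subseteq># P \<longrightarrow> A \<inter> B = {})}"

definition num_packings :: "(int ^ 'd) set \<Rightarrow> (int ^ 'd) set set multiset \<Rightarrow> nat \<Rightarrow> nat" where
  "num_packings Z S n = card (packings S (cell_graph Z n))"

lemma equiv_translation_rel:
  "equiv {A :: (int ^ 'd) set. finite A} translation_rel"
proof (rule equivI)
  show "refl_on {A :: (int ^ 'd) set. finite A} translation_rel"
    unfolding refl_on_def translation_rel_def
    by (auto intro!: exI[of _ 0])
  show "translation_rel \<subseteq> {A :: (int ^ 'd) set. finite A} \<times> {A. finite A}"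
    unfolding translation_rel_def by auto
  show "sym (translation_rel :: ((int ^ 'd) set \<times> (int ^ 'd) set) set)"
    unfolding sym_def translation_rel_def
  proof clarsimp
    fix A :: "(int ^ 'd) set" and t
    have "A = (\<lambda>v. - t + v) ` (\<lambda>v. t + v) ` A"
      by (simp add: image_image)
    then show "\<exists>s. A = (\<lambda>v. s + v) ` (\<lambda>v. t + v) ` A" ..
  qed
  show "trans (translation_rel :: ((int ^ 'd) set \<times> (int ^ 'd) set) set)"
    unfolding trans_def translation_rel_def
  proof clarsimp
    fix A :: "(int ^ 'd) set" and s t
    have "(\<lambda>v. s + v) ` (\<lambda>v. t + v) ` A = (\<lambda>v. s + t + v) ` A"
      by (simp add: image_image add.assoc)
    then show "\<exists>u. (\<lambda>v. s + v) ` (\<lambda>v. t + v) ` A = (\<lambda>v. u + v) ` A" ..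
  qed
qed

lemma mem_cell_graph_iff:
  "v \<in> vertices (cell_graph Z n) \<longleftrightarrow>
     (\<exists>z\<in>Z. \<forall>i. int n * z $ i \<le> v $ i \<and> v $ i \<le> int n * z $ i + int n)"
proof -
  have "real_point v \<in> scaled_cell n z \<longleftrightarrow>
     (\<forall>i. int n * z $ i \<le> v $ i \<and> v $ i \<le> int n * z $ i + int n)" for z
  proof -
    have "real n * real_of_int a \<le> real_of_int b \<longleftrightarrow> int n * a \<le> b"
      "real_of_int b \<le> real n * real_of_int a + real n \<longleftrightarrow> b \<le> int n * a + int n" for a b :: int
      using of_int_le_iff[of "int n * a" b, where 'a = real]
        of_int_le_iff[of b "int n * a + int n", where 'a = real]
      by simp_all
    then show ?thesis
      by (simp add: scaled_cell_def mem_box_cart real_point_def)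
  qed
  then show ?thesis
    by (simp add: cell_graph_def infinite_grid_def)
qed

lemma finite_vertices_cell_graph:
  fixes Z :: "(int ^ 'd) set"
  assumes "finite Z"
  shows "finite (vertices (cell_graph Z n))"
proof -
  have "finite {v :: int ^ 'd. \<forall>i. int n * z $ i \<le> v $ i \<and> v $ i \<le> int n * z $ i + int n}"
    for z :: "int ^ 'd"
  proof (rule finite_subset)
    show "{v :: int ^ 'd. \<forall>i. int n * z $ i \<le> v $ i \<and> v $ i \<le> int n * z $ i + int n} \<subseteq>
        {v. \<forall>i. v $ i \<in> {int n * z $ i..int n * z $ i + int n}}"
      by auto
    show "finite {v :: int ^ 'd. \<forall>i. v $ i \<in> {int n * z $ i..int n * z $ i + int n}}"
    proof (rule finite_subset[OF _ finite_imageI[where h = vec_lambda]])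
      show "finite (PiE UNIV (\<lambda>i. {int n * z $ i..int n * z $ i + int n}))"
        by (intro finite_PiE) auto
      show "{v :: int ^ 'd. \<forall>i. v $ i \<in> {int n * z $ i..int n * z $ i + int n}} \<subseteq>
        vec_lambda ` (PiE UNIV (\<lambda>i. {int n * z $ i..int n * z $ i + int n}))"
      proof
        fix v :: "int ^ 'd"
        assume "v \<in> {v. \<forall>i. v $ i \<in> {int n * z $ i..int n * z $ i + int n}}"
        then show "v \<in> vec_lambda ` (PiE UNIV (\<lambda>i. {int n * z $ i..int n * z $ i + int n}))"
          by (intro image_eqI[of _ _ "vec_nth v"]) auto
      qed
    qed
  qed
  moreover have "vertices (cell_graph Z n) =
     (\<Union>z\<in>Z. {v. \<forall>i. int n * z $ i \<le> v $ i \<and> v $ i \<le> int n * z $ i + int n})"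
    by (simp add: set_eq_iff mem_cell_graph_iff)
  ultimately show ?thesis
    using assms by simp
qed

(* Since card is 0 on infinite sets, num_packings is a genuine count only because of this. *)
lemma finite_packings:
  fixes Z :: "(int ^ 'd) set"
  assumes "finite Z"
  shows "finite (packings S (cell_graph Z n))"
proof (rule finite_subset)
  let ?V = "vertices (cell_graph Z n)"
  show "packings S (cell_graph Z n) \<subseteq> {P. set_mset P \<subseteq> Pow ?V \<and> size P = size S}"
  proof
    fix P assume "P \<in> packings S (cell_graph Z n)"
    then have r: "rel_mset (\<lambda>F A. A \<in> placements F (cell_graph Z n)) S P"
      by (simp add: packings_def)
    have "A \<in> Pow ?V" if A: "A \<in># P" for A
    proof -
      obtain F where "A \<in> placements F (cell_graph Z n)"
        using r A by (force simp: multiset.in_rel)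
      then show ?thesis by (simp add: placements_def)
    qed
    then show "P \<in> {P. set_mset P \<subseteq> Pow ?V \<and> size P = size S}"
      using rel_mset_size[OF r] by auto
  qed
  have "finite (Pow ?V)" using finite_vertices_cell_graph[OF assms] by simp
  then have "finite (mset ` {xs. set xs \<subseteq> Pow ?V \<and> length xs = size S})"
    by (intro finite_imageI finite_lists_length_eq)
  moreover have "{P. set_mset P \<subseteq> Pow ?V \<and> size P = size S} \<subseteq>
      mset ` {xs. set xs \<subseteq> Pow ?V \<and> length xs = size S}"
  proof
    fix P assume "P \<in> {P. set_mset P \<subseteq> Pow ?V \<and> size P = size S}"
    moreover obtain xs where "mset xs = P" using ex_mset by blast
    ultimately show "P \<in> mset ` {xs. set xs \<subseteq> Pow ?V \<and> length xs = size S}"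
      by (auto intro!: image_eqI[of _ _ xs])
  qed
  ultimately show "finite {P. set_mset P \<subseteq> Pow ?V \<and> size P = size S}"
    by (rule finite_subset[rotated])
qed

end

theory Submission
  imports Defs
begin

text \<open>
  Fix representatives \<open>A i\<close> of the nonempty members of \<open>S\<close>, listed in some order. Placing them amounts to
  choosing translation vectors \<open>t i\<close>, and two conditions have to hold.

  The first is that each \<open>t i + A i\<close> lies in \<open>G\<^sup>n\<close>. The vertex set of \<open>G\<^sup>n\<close> is a finite union of
  boxes whose bounds are linear functions of \<open>n\<close>. Unions of such boxes, with bounds that are
  linear for large \<open>n\<close>, are closed under translation by a fixed vector and under finite
  intersection, so the admissible \<open>t i\<close> form a set of this kind. The number of lattice points
  in a box is the product of the numbers of integers in its sides, hence a polynomial in \<open>n\<close> for large \<open>n\<close>, and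
  inclusion-exclusion extends this to unions of boxes (\<open>linear_box_union_card\<close>).

  The second is that the placed figures are disjoint. Since \<open>t i + a = t j + b\<close> says
  \<open>t i = t j + (b - a)\<close>, this condition forbids finitely many values, independent of \<open>n\<close>, for
  each difference \<open>t i - t j\<close>. The number of \<open>t\<close> is polynomial for large \<open>n\<close>
  (\<open>eventually_poly_card_configs\<close>): without forbidden differences it is a product of counts as
  above, and forbidding one more difference \<open>t i = t j + d\<close> subtracts the number of \<open>t\<close> that satisfy
  this equation, which is a counting problem of the same form with the variable \<open>t i\<close> eliminated.

  Finally, ordered placements have to be compared with packings. Every packing arises from the same
  positive number of ordered placements, namely the product of the factorials of the multiplicities
  of the nonempty figures in \<open>S\<close> (\<open>card_labelled_packings\<close>). Dividing by this constant leaves a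
  polynomial with rational coefficients; it takes integer values for all large \<open>n\<close>, and therefore
  at all integers (\<open>integer_valued_poly\<close>).
\<close>

section \<open>Eventually polynomial functions\<close>

definition eventually_poly :: "(nat \<Rightarrow> rat) \<Rightarrow> bool" where
  "eventually_poly f \<longleftrightarrow> (\<exists>p. \<forall>\<^sub>F n in sequentially. f n = poly p (of_nat n))"

lemma eventually_polyI:
  assumes "\<forall>\<^sub>F n in sequentially. f n = poly p (of_nat n)"
  shows "eventually_poly f"
  using assms by (auto simp: eventually_poly_def)

lemma eventually_poly_const: "eventually_poly (\<lambda>n. c)"
  by (rule eventually_polyI[of _ "[:c:]"]) simp

lemma eventually_poly_add:
  assumes "eventually_poly f" "eventually_poly g"
  shows "eventually_poly (\<lambda>n. f n + g n)"
proof -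
  obtain p q where "\<forall>\<^sub>F n in sequentially. f n = poly p (of_nat n)"
    "\<forall>\<^sub>F n in sequentially. g n = poly q (of_nat n)"
    using assms by (auto simp: eventually_poly_def)
  then have "\<forall>\<^sub>F n in sequentially. f n + g n = poly (p + q) (of_nat n)"
    by eventually_elim simp
  then show ?thesis by (rule eventually_polyI)
qed

lemma eventually_poly_mult:
  assumes "eventually_poly f" "eventually_poly g"
  shows "eventually_poly (\<lambda>n. f n * g n)"
proof -
  obtain p q where "\<forall>\<^sub>F n in sequentially. f n = poly p (of_nat n)"
    "\<forall>\<^sub>F n in sequentially. g n = poly q (of_nat n)"
    using assms by (auto simp: eventually_poly_def)
  then have "\<forall>\<^sub>F n in sequentially. f n * g n = poly (p * q) (of_nat n)"
    by eventually_elim simp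
  then show ?thesis by (rule eventually_polyI)
qed

lemma eventually_poly_diff:
  assumes "eventually_poly f" "eventually_poly g"
  shows "eventually_poly (\<lambda>n. f n - g n)"
  using eventually_poly_add[OF assms(1) eventually_poly_mult[OF eventually_poly_const[of "-1"] assms(2)]]
  by simp

lemma eventually_poly_prod:
  assumes "finite I" "\<And>i. i \<in> I \<Longrightarrow> eventually_poly (f i)"
  shows "eventually_poly (\<lambda>n. \<Prod>i\<in>I. f i n)"
  using assms
  by (induction I) (simp_all add: eventually_poly_const eventually_poly_mult)

text \<open>Passing to the difference \<open>p(x + 1) - p(x)\<close> lowers the degree, and integrality of the
  differences carries integrality of \<open>p\<close> down from the large arguments to all others.\<close>

lemma integer_valued_poly:
  fixes p :: "rat poly"
  assumes "\<And>n. n \<ge> N \<Longrightarrow> poly p (of_nat n) \<in> \<int>"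
  shows "poly p (of_int x) \<in> \<int>"
  using assms
proof (induction "degree p" arbitrary: p x rule: less_induct)
  case less
  show ?case
  proof (cases "degree p = 0")
    case True
    then obtain c where "p = [:c:]" by (rule degree_eq_zeroE)
    then show ?thesis using less.prems[of N] by simp
  next
    case False
    define q where "q = pcompose p [:1, 1:] - p"
    have q: "poly q y = poly p (y + 1) - poly p y" for y
      by (simp add: q_def poly_pcompose add.commute)
    \<comment> \<open>The leading terms of \<open>p(x + 1)\<close> and \<open>p(x)\<close> cancel.\<close>
    have "coeff q (degree p) = 0"
      using lead_coeff_comp[of "[:1, 1:]" p] by (simp add: q_def degree_pcompose)
    moreover have "degree q \<le> degree p"
      unfolding q_def by (rule degree_diff_le) (simp_all add: degree_pcompose)
    ultimately have "degree q < degree p"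
      using False by (metis degree_0 leading_coeff_0_iff le_neq_implies_less neq0_conv)
    moreover have "poly q (of_nat n) \<in> \<int>" if "n \<ge> N" for n
      using less.prems[of n] less.prems[of "Suc n"] that by (simp add: q add.commute)
    ultimately have step: "poly p (of_int y + 1) - poly p (of_int y) \<in> \<int>" for y
      using less.hyps[of q y] by (simp add: q)
    show ?thesis
    proof (cases "x \<le> int N")
      case True
      then show ?thesis
      proof (induction x rule: int_le_induct)
        case base
        then show ?case using less.prems[of N] by simp
      next
        case (step i)
        then show ?case
          using \<open>poly p (of_int i) \<in> \<int>\<close> \<open>\<And>y. poly p (of_int y + 1) - poly p (of_int y) \<in> \<int>\<close>[of "i - 1"]
            Ints_diff[of "poly p (of_int i)" "poly p (of_int i) - poly p (of_int i - 1)"]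
          by simp
      qed
    next
      case False
      then show ?thesis using less.prems[of "nat x"] by simp
    qed
  qed
qed

section \<open>Finite unions of boxes with linear bounds\<close>

definition eventually_linear :: "(nat \<Rightarrow> int) \<Rightarrow> bool" where
  "eventually_linear f \<longleftrightarrow> (\<exists>a b. \<forall>\<^sub>F n in sequentially. f n = a * int n + b)"

lemma eventually_linearI: "eventually_linear (\<lambda>n. a * int n + b)"
  unfolding eventually_linear_def by (intro exI[of _ a] exI[of _ b]) simp

lemma eventually_linear_add_const:
  assumes "eventually_linear f"
  shows "eventually_linear (\<lambda>n. f n + c)"
proof -
  obtain a b where "\<forall>\<^sub>F n in sequentially. f n = a * int n + b"
    using assms by (auto simp: eventually_linear_def)
  then have "\<forall>\<^sub>F n in sequentially. f n + c = a * int n + (b + c)"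
    by eventually_elim simp
  then show ?thesis unfolding eventually_linear_def by blast
qed

lemma eventually_linear_diff:
  assumes "eventually_linear f" "eventually_linear g"
  shows "eventually_linear (\<lambda>n. f n - g n)"
proof -
  obtain a b a' b' where "\<forall>\<^sub>F n in sequentially. f n = a * int n + b"
    "\<forall>\<^sub>F n in sequentially. g n = a' * int n + b'"
    using assms by (auto simp: eventually_linear_def)
  then have "\<forall>\<^sub>F n in sequentially. f n - g n = (a - a') * int n + (b - b')"
    by eventually_elim (simp add: algebra_simps)
  then show ?thesis unfolding eventually_linear_def by blast
qed

text \<open>A linear function has eventually constant sign, so two of them are eventually ordered.\<close>

lemma eventually_linear_sign:
  assumes "eventually_linear f"
  shows "(\<forall>\<^sub>F n in sequentially. f n \<ge> 0) \<or> (\<forall>\<^sub>F n in sequentially. f n \<le> 0)"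
proof -
  obtain a b where ab: "\<forall>\<^sub>F n in sequentially. f n = a * int n + b"
    using assms by (auto simp: eventually_linear_def)
  have large: "\<forall>\<^sub>F n in sequentially. n \<ge> nat \<bar>b\<bar>"
    by (rule eventually_ge_at_top)
  consider "a = 0" | "a \<ge> 1" | "a \<le> -1" by linarith
  then show ?thesis
  proof cases
    case 1
    have "\<forall>\<^sub>F n in sequentially. f n = b" using ab 1 by simp
    then have "b \<ge> 0 \<Longrightarrow> \<forall>\<^sub>F n in sequentially. f n \<ge> 0" "b \<le> 0 \<Longrightarrow> \<forall>\<^sub>F n in sequentially. f n \<le> 0"
      by (auto elim: eventually_mono)
    then show ?thesis by linarith
  next
    case 2
    have "\<forall>\<^sub>F n in sequentially. f n \<ge> 0"
      using ab large
    proof eventually_elim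
      case (elim n)
      have "1 * int n \<le> a * int n" using 2 by (intro mult_right_mono) auto
      then show ?case using elim by linarith
    qed
    then show ?thesis ..
  next
    case 3
    have "\<forall>\<^sub>F n in sequentially. f n \<le> 0"
      using ab large
    proof eventually_elim
      case (elim n)
      have "a * int n \<le> - 1 * int n" using 3 by (intro mult_right_mono) auto
      then show ?case using elim by linarith
    qed
    then show ?thesis ..
  qed
qed

lemma eventually_linear_cong:
  assumes "\<forall>\<^sub>F n in sequentially. f n = g n" "eventually_linear f"
  shows "eventually_linear g"
proof -
  obtain a b where "\<forall>\<^sub>F n in sequentially. f n = a * int n + b"
    using assms by (auto simp: eventually_linear_def)
  with assms(1) have "\<forall>\<^sub>F n in sequentially. g n = a * int n + b"
    by eventually_elim simp
  then show ?thesis unfolding eventually_linear_def by blast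
qed

lemma eventually_linear_max:
  assumes "eventually_linear f" "eventually_linear g"
  shows "eventually_linear (\<lambda>n. max (f n) (g n))"
  using eventually_linear_sign[OF eventually_linear_diff[OF assms]]
proof
  assume "\<forall>\<^sub>F n in sequentially. f n - g n \<ge> 0"
  then have "\<forall>\<^sub>F n in sequentially. f n = max (f n) (g n)" by eventually_elim simp
  then show ?thesis by (rule eventually_linear_cong) fact
next
  assume "\<forall>\<^sub>F n in sequentially. f n - g n \<le> 0"
  then have "\<forall>\<^sub>F n in sequentially. g n = max (f n) (g n)" by eventually_elim simp
  then show ?thesis by (rule eventually_linear_cong) fact
qed

lemma eventually_linear_min:
  assumes "eventually_linear f" "eventually_linear g"
  shows "eventually_linear (\<lambda>n. min (f n) (g n))"
  using eventually_linear_sign[OF eventually_linear_diff[OF assms]]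
proof
  assume "\<forall>\<^sub>F n in sequentially. f n - g n \<ge> 0"
  then have "\<forall>\<^sub>F n in sequentially. g n = min (f n) (g n)" by eventually_elim simp
  then show ?thesis by (rule eventually_linear_cong) fact
next
  assume "\<forall>\<^sub>F n in sequentially. f n - g n \<le> 0"
  then have "\<forall>\<^sub>F n in sequentially. f n = min (f n) (g n)" by eventually_elim simp
  then show ?thesis by (rule eventually_linear_cong) fact
qed

lemma eventually_poly_nat_linear:
  assumes "eventually_linear f"
  shows "eventually_poly (\<lambda>n. of_nat (nat (f n)))"
proof -
  have "eventually_linear (\<lambda>n. max (f n) 0)"
    using eventually_linear_max[OF assms eventually_linearI[of 0 0]] by simp
  then obtain a b where "\<forall>\<^sub>F n in sequentially. max (f n) 0 = a * int n + b"
    by (auto simp: eventually_linear_def)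
  then have "\<forall>\<^sub>F n in sequentially. of_nat (nat (f n)) = poly [:of_int b, of_int a:] (of_nat n :: rat)"
  proof eventually_elim
    case (elim n)
    have "(of_nat (nat (f n)) :: rat) = of_int (max (f n) 0)"
      by (simp add: max_def)
    then show ?case by (simp add: elim mult.commute add.commute)
  qed
  then show ?thesis by (rule eventually_polyI)
qed

definition linear_box :: "(nat \<Rightarrow> (int ^ 'd) set) \<Rightarrow> bool" where
  "linear_box X \<longleftrightarrow> (\<exists>l u. (\<forall>i. eventually_linear (l i) \<and> eventually_linear (u i)) \<and>
     (\<forall>n v. v \<in> X n \<longleftrightarrow> (\<forall>i. l i n \<le> v $ i \<and> v $ i \<le> u i n)))"

lemma linear_boxE:
  assumes "linear_box X"
  obtains l u where "\<And>i. eventually_linear (l i)" "\<And>i. eventually_linear (u i)"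
    "\<And>v n. v \<in> X n \<longleftrightarrow> (\<forall>i. l i n \<le> v $ i \<and> v $ i \<le> u i n)"
proof -
  obtain l u where "\<forall>i. eventually_linear (l i) \<and> eventually_linear (u i)"
    "\<forall>n v. v \<in> X n \<longleftrightarrow> (\<forall>i. l i n \<le> v $ i \<and> v $ i \<le> u i n)"
    using assms unfolding linear_box_def by (elim exE conjE)
  then show thesis by (intro that[of l u]) simp_all
qed

lemma linear_boxI:
  assumes "\<And>i. eventually_linear (l i)" "\<And>i. eventually_linear (u i)"
    and "\<And>v n. v \<in> X n \<longleftrightarrow> (\<forall>i. l i n \<le> v $ i \<and> v $ i \<le> u i n)"
  shows "linear_box X"
  unfolding linear_box_def
  by (rule exI[of _ l], rule exI[of _ u]) (simp add: assms)

lemma linear_box_Int: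
  assumes "linear_box X" "linear_box Y"
  shows "linear_box (\<lambda>n. X n \<inter> Y n)"
proof -
  obtain l u where X: "\<And>i. eventually_linear (l i)" "\<And>i. eventually_linear (u i)"
    "\<And>v n. v \<in> X n \<longleftrightarrow> (\<forall>i. l i n \<le> v $ i \<and> v $ i \<le> u i n)"
    using assms(1) by (rule linear_boxE) (rule that; simp)
  obtain l' u' where Y: "\<And>i. eventually_linear (l' i)" "\<And>i. eventually_linear (u' i)"
    "\<And>v n. v \<in> Y n \<longleftrightarrow> (\<forall>i. l' i n \<le> v $ i \<and> v $ i \<le> u' i n)"
    using assms(2) by (rule linear_boxE) (rule that; simp)
  show ?thesis
  proof (rule linear_boxI)
    show "eventually_linear (\<lambda>n. max (l i n) (l' i n))" for i
      by (rule eventually_linear_max[OF X(1) Y(1)])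
    show "eventually_linear (\<lambda>n. min (u i n) (u' i n))" for i
      by (rule eventually_linear_min[OF X(2) Y(2)])
    show "v \<in> X n \<inter> Y n \<longleftrightarrow>
        (\<forall>i. max (l i n) (l' i n) \<le> v $ i \<and> v $ i \<le> min (u i n) (u' i n))" for v n
      by (auto simp: X(3) Y(3))
  qed
qed

lemma linear_box_translate:
  assumes "linear_box X"
  shows "linear_box (\<lambda>n. {v. v + d \<in> X n})"
proof -
  obtain l u where X: "\<And>i. eventually_linear (l i)" "\<And>i. eventually_linear (u i)"
    "\<And>v n. v \<in> X n \<longleftrightarrow> (\<forall>i. l i n \<le> v $ i \<and> v $ i \<le> u i n)"
    using assms(1) by (rule linear_boxE) (rule that; simp)
  show ?thesis
  proof (rule linear_boxI)
    show "eventually_linear (\<lambda>n. l i n + - d $ i)" for i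
      by (rule eventually_linear_add_const[OF X(1)])
    show "eventually_linear (\<lambda>n. u i n + - d $ i)" for i
      by (rule eventually_linear_add_const[OF X(2)])
    show "v \<in> {v. v + d \<in> X n} \<longleftrightarrow>
        (\<forall>i. l i n + - d $ i \<le> v $ i \<and> v $ i \<le> u i n + - d $ i)" for v n
      by (simp add: X(3) diff_le_eq le_diff_eq)
  qed
qed

lemma int_box_as_image:
  fixes l u :: "'d::finite \<Rightarrow> int"
  shows "{v :: int ^ 'd. \<forall>i. l i \<le> v $ i \<and> v $ i \<le> u i} = vec_lambda ` (PiE UNIV (\<lambda>i. {l i..u i}))"
proof (intro equalityI subsetI)
  fix v :: "int ^ 'd"
  assume "v \<in> {v. \<forall>i. l i \<le> v $ i \<and> v $ i \<le> u i}"
  then show "v \<in> vec_lambda ` (PiE UNIV (\<lambda>i. {l i..u i}))"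
    by (intro image_eqI[of _ _ "vec_nth v"]) auto
qed auto

lemma card_int_box:
  fixes l u :: "'d::finite \<Rightarrow> int"
  shows "card {v :: int ^ 'd. \<forall>i. l i \<le> v $ i \<and> v $ i \<le> u i} = (\<Prod>i\<in>UNIV. nat (u i - l i + 1))"
proof -
  have "inj_on vec_lambda (PiE UNIV (\<lambda>i. {l i..u i}))"
    by (rule inj_onI) (simp add: vec_lambda_inject)
  then show ?thesis
    by (simp add: int_box_as_image card_image card_PiE add.commute)
qed

lemma linear_box_finite:
  fixes X :: "nat \<Rightarrow> (int ^ 'd) set"
  assumes "linear_box X"
  shows "finite (X n)"
proof -
  obtain l u where "\<And>v n. v \<in> X n \<longleftrightarrow> (\<forall>i. l i n \<le> v $ i \<and> v $ i \<le> u i n)"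
    using assms by (rule linear_boxE) (rule that; simp)
  then have "X n = {v. \<forall>i. l i n \<le> v $ i \<and> v $ i \<le> u i n}" by auto
  also have "\<dots> = vec_lambda ` (PiE UNIV (\<lambda>i. {l i n..u i n}))"
    by (rule int_box_as_image)
  also have "finite \<dots>" by (intro finite_imageI finite_PiE) auto
  finally show ?thesis .
qed

lemma linear_box_card:
  fixes X :: "nat \<Rightarrow> (int ^ 'd) set"
  assumes "linear_box X"
  shows "eventually_poly (\<lambda>n. of_nat (card (X n)))"
proof -
  obtain l u where X: "\<And>i. eventually_linear (l i)" "\<And>i. eventually_linear (u i)"
    "\<And>v n. v \<in> X n \<longleftrightarrow> (\<forall>i. l i n \<le> v $ i \<and> v $ i \<le> u i n)"
    using assms by (rule linear_boxE) (rule that; simp)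
  then have "X n = {v. \<forall>i. l i n \<le> v $ i \<and> v $ i \<le> u i n}" for n by auto
  moreover
  have "eventually_poly (\<lambda>n. \<Prod>i\<in>UNIV. of_nat (nat (u i n - l i n + 1)))"
  proof (rule eventually_poly_prod)
    show "eventually_poly (\<lambda>n. of_nat (nat (u i n - l i n + 1)))" for i
      by (rule eventually_poly_nat_linear[OF eventually_linear_add_const[OF
            eventually_linear_diff[OF X(2) X(1)]]])
  qed simp
  ultimately show ?thesis by (simp add: card_int_box)
qed

text \<open>The boxes are fixed functions of \<open>n\<close>, so their number does not grow with \<open>n\<close>; this makes
  inclusion-exclusion a formula that is uniform in \<open>n\<close>.\<close>

definition linear_box_union :: "(nat \<Rightarrow> (int ^ 'd) set) \<Rightarrow> bool" where
  "linear_box_union X \<longleftrightarrow>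
     (\<exists>F. finite F \<and> (\<forall>B\<in>F. linear_box B) \<and> X = (\<lambda>n. \<Union>B\<in>F. B n))"

lemma linear_box_union_Int:
  assumes "linear_box_union X" "linear_box_union Y"
  shows "linear_box_union (\<lambda>n. X n \<inter> Y n)"
proof -
  obtain F where F: "finite F" "\<forall>B\<in>F. linear_box B" "X = (\<lambda>n. \<Union>B\<in>F. B n)"
    using assms(1) unfolding linear_box_union_def by blast
  obtain H where H: "finite H" "\<forall>B\<in>H. linear_box B" "Y = (\<lambda>n. \<Union>B\<in>H. B n)"
    using assms(2) unfolding linear_box_union_def by blast
  show ?thesis
    unfolding linear_box_union_def
    by (rule exI[of _ "(\<lambda>(B, B') n. B n \<inter> B' n) ` (F \<times> H)"])
      (use F H in \<open>auto simp: fun_eq_iff intro: linear_box_Int\<close>)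
qed

lemma linear_box_union_translate:
  assumes "linear_box_union X"
  shows "linear_box_union (\<lambda>n. {v. v + d \<in> X n})"
proof -
  obtain F where F: "finite F" "\<forall>B\<in>F. linear_box B" "X = (\<lambda>n. \<Union>B\<in>F. B n)"
    using assms(1) unfolding linear_box_union_def by blast
  show ?thesis
    unfolding linear_box_union_def
    by (rule exI[of _ "(\<lambda>B n. {v. v + d \<in> B n}) ` F"])
      (use F in \<open>auto simp: fun_eq_iff intro: linear_box_translate\<close>)
qed

lemma linear_box_union_finite_Int:
  assumes "finite A" "A \<noteq> {}" "\<And>a. a \<in> A \<Longrightarrow> linear_box_union (X a)"
  shows "linear_box_union (\<lambda>n. \<Inter>a\<in>A. X a n)"
  using assms
  by (induction A rule: finite_ne_induct) (simp_all add: linear_box_union_Int)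

lemma linear_box_union_finite:
  assumes "linear_box_union X"
  shows "finite (X n)"
  using assms unfolding linear_box_union_def by (auto intro: linear_box_finite)

text \<open>Inclusion-exclusion: boxes are closed under intersection, so removing one box from the union
  leaves two shorter unions of boxes to count.\<close>

lemma linear_box_UN_card:
  fixes B :: "'a \<Rightarrow> nat \<Rightarrow> (int ^ 'd) set"
  assumes "finite J" "\<And>j. j \<in> J \<Longrightarrow> linear_box (B j)"
  shows "eventually_poly (\<lambda>n. of_nat (card (\<Union>j\<in>J. B j n)))"
  using assms
proof (induction J arbitrary: B)
  case empty
  show ?case using eventually_poly_const[of 0] by simp
next
  case (insert k J)
  note box = insert.prems
  have fin: "finite (B j n)" if "j \<in> insert k J" for j n
    using box[OF that] by (rule linear_box_finite)
  have "(of_nat (card (\<Union>j\<in>insert k J. B j n)) :: rat) =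
      of_nat (card (B k n)) + of_nat (card (\<Union>j\<in>J. B j n)) - of_nat (card (\<Union>j\<in>J. B k n \<inter> B j n))"
    for n
  proof -
    have "card (B k n) + card (\<Union>j\<in>J. B j n) =
        card (B k n \<union> (\<Union>j\<in>J. B j n)) + card (B k n \<inter> (\<Union>j\<in>J. B j n))"
    proof (rule card_Un_Int)
      show "finite (B k n)" by (rule fin) simp
      show "finite (\<Union>j\<in>J. B j n)" using insert.hyps(1) by (rule finite_UN_I) (rule fin, simp)
    qed
    then have "(of_nat (card (B k n)) + of_nat (card (\<Union>j\<in>J. B j n)) :: rat) =
        of_nat (card (B k n \<union> (\<Union>j\<in>J. B j n))) + of_nat (card (B k n \<inter> (\<Union>j\<in>J. B j n)))"
      unfolding of_nat_add[symmetric] by (rule arg_cong)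
    moreover have "B k n \<inter> (\<Union>j\<in>J. B j n) = (\<Union>j\<in>J. B k n \<inter> B j n)"
      by (rule Int_UN_distrib)
    ultimately show ?thesis by (simp only: UN_insert)
  qed
  moreover have "eventually_poly (\<lambda>n. of_nat (card (B k n)) + of_nat (card (\<Union>j\<in>J. B j n)) -
      of_nat (card (\<Union>j\<in>J. B k n \<inter> B j n)))"
  proof (rule eventually_poly_diff[OF eventually_poly_add])
    show "eventually_poly (\<lambda>n. of_nat (card (B k n)))"
      by (rule linear_box_card) (simp add: box)
    show "eventually_poly (\<lambda>n. of_nat (card (\<Union>j\<in>J. B j n)))"
      by (rule insert.IH) (simp add: box)
    show "eventually_poly (\<lambda>n. of_nat (card (\<Union>j\<in>J. B k n \<inter> B j n)))"
      by (rule insert.IH, rule linear_box_Int) (simp_all add: box)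
  qed
  ultimately show ?case by (simp only:)
qed

lemma linear_box_union_card:
  fixes X :: "nat \<Rightarrow> (int ^ 'd) set"
  assumes "linear_box_union X"
  shows "eventually_poly (\<lambda>n. of_nat (card (X n)))"
proof -
  obtain F where F: "finite F" "\<forall>B\<in>F. linear_box B" "X = (\<lambda>n. \<Union>B\<in>F. B n)"
    using assms unfolding linear_box_union_def by blast
  then show ?thesis using linear_box_UN_card[of F "\<lambda>B. B"] by simp
qed

lemma linear_box_union_cell_graph:
  fixes Z :: "(int ^ 'd) set"
  assumes "finite Z"
  shows "linear_box_union (\<lambda>n. vertices (cell_graph Z n))"
  unfolding linear_box_union_def
proof (intro exI conjI)
  let ?B = "\<lambda>z n. {v :: int ^ 'd. \<forall>i. z $ i * int n + 0 \<le> v $ i \<and> v $ i \<le> (z $ i + 1) * int n + 0}"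
  show "finite (?B ` Z)" using assms by simp
  show "\<forall>B\<in>?B ` Z. linear_box B"
  proof
    fix B assume "B \<in> ?B ` Z"
    then obtain z where B: "B = ?B z" by auto
    show "linear_box B"
      by (rule linear_boxI[where l = "\<lambda>i n. z $ i * int n + 0" and
            u = "\<lambda>i n. (z $ i + 1) * int n + 0"], rule eventually_linearI, rule eventually_linearI)
        (simp add: B)
  qed
  show "(\<lambda>n. vertices (cell_graph Z n)) = (\<lambda>n. \<Union>B\<in>?B ` Z. B n)"
    by (auto simp: fun_eq_iff set_eq_iff mem_cell_graph_iff algebra_simps)
qed

section \<open>Counting configurations with forbidden differences\<close>

text \<open>A configuration assigns to each index a translation vector. The set \<open>C\<close> of forbidden
  differences encodes disjointness of the translated figures. The two indices of a triple in \<open>C\<close>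
  may coincide, since eliminating a variable can produce such triples.\<close>

definition configs :: "'i set \<Rightarrow> ('i \<Rightarrow> nat \<Rightarrow> 'v set) \<Rightarrow> ('i \<times> 'i \<times> 'v) set \<Rightarrow> nat \<Rightarrow>
    ('i \<Rightarrow> 'v :: ab_group_add) set" where
  "configs I X C n = {t \<in> PiE I (\<lambda>i. X i n). \<forall>(i, j, d)\<in>C. t i \<noteq> t j + d}"

text \<open>The effect of the substitution \<open>t i = t j + d\<close> on the condition \<open>t a \<noteq> t b + e\<close>.\<close>

definition substitute :: "'i \<Rightarrow> 'i \<Rightarrow> 'v :: ab_group_add \<Rightarrow> 'i \<times> 'i \<times> 'v \<Rightarrow> 'i \<times> 'i \<times> 'v" where
  "substitute i j d = (\<lambda>(a, b, e). (if a = i then j else a, if b = i then j else b,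
     e + (if b = i then d else 0) - (if a = i then d else 0)))"

text \<open>The value \<open>t i = t j + d\<close> is determined by \<open>t j\<close>. Forgetting it moves the condition on \<open>t i\<close>
  over to \<open>t j\<close>, and the set for \<open>j\<close> remains a finite union of boxes if both sets were.\<close>

lemma card_configs_eliminate:
  assumes "i \<notin> I" "j \<in> I" "C \<subseteq> insert i I \<times> insert i I \<times> UNIV"
  shows "card {t \<in> configs (insert i I) X C n. t i = t j + d} =
    card (configs I (X(j := \<lambda>n. X j n \<inter> {v. v + d \<in> X i n})) (substitute i j d ` C) n)"
    (is "card ?L = card ?R")
proof (rule bij_betw_same_card)
  have ij: "i \<noteq> j" using assms by auto
  have cond: "(\<forall>(a, b, e)\<in>substitute i j d ` C. s a \<noteq> s b + e) \<longleftrightarrow> (\<forall>(a, b, e)\<in>C. t a \<noteq> t b + e)"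
    if "t i = s j + d" "\<And>k. k \<in> I \<Longrightarrow> t k = s k" for s t
  proof -
    have "(case substitute i j d c of (a, b, e) \<Rightarrow> s a \<noteq> s b + e) \<longleftrightarrow> (case c of (a, b, e) \<Rightarrow> t a \<noteq> t b + e)"
      if "c \<in> C" for c
    proof -
      obtain a b e where c: "c = (a, b, e)" by (cases c)
      define a' b' where "a' = (if a = i then j else a)" and "b' = (if b = i then j else b)"
      define f g where "f = (if a = i then d else 0)" and "g = (if b = i then d else 0)"
      have "a = i \<or> a \<in> I" "b = i \<or> b \<in> I" using assms(3) that c by auto
      then have "t a = s a' + f" "t b = s b' + g"
        using \<open>t i = s j + d\<close> \<open>\<And>k. k \<in> I \<Longrightarrow> t k = s k\<close>
        by (auto simp: a'_def b'_def f_def g_def)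
      moreover have "s a' = s b' + (e + g - f) \<longleftrightarrow> s a' + f = s b' + g + e"
        by (simp add: add_diff_eq eq_diff_eq ac_simps)
      ultimately show ?thesis
        by (simp add: c substitute_def a'_def b'_def f_def g_def)
    qed
    then show ?thesis by simp
  qed
  have L: "t \<in> ?L \<longleftrightarrow> t \<in> extensional (insert i I) \<and> (\<forall>k\<in>I. t k \<in> X k n) \<and> t i \<in> X i n \<and>
      (\<forall>(a, b, e)\<in>C. t a \<noteq> t b + e) \<and> t i = t j + d" for t
    unfolding configs_def by (simp only: PiE_iff mem_Collect_eq) blast
  have R: "s \<in> ?R \<longleftrightarrow> s \<in> extensional I \<and> (\<forall>k\<in>I. s k \<in> X k n) \<and> s j + d \<in> X i n \<and>
      (\<forall>(a, b, e)\<in>substitute i j d ` C. s a \<noteq> s b + e)" for s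
  proof -
    have "(\<forall>k\<in>I. s k \<in> (X(j := \<lambda>n. X j n \<inter> {v. v + d \<in> X i n})) k n) \<longleftrightarrow>
        (\<forall>k\<in>I. s k \<in> X k n) \<and> s j + d \<in> X i n"
      using assms(2) by auto
    then show ?thesis
      unfolding configs_def by (simp only: PiE_iff mem_Collect_eq) blast
  qed
  show "bij_betw (\<lambda>t. restrict t I) ?L ?R"
  proof (rule bij_betw_byWitness[where f' = "\<lambda>s. s(i := s j + d)"])
    show "\<forall>t\<in>?L. (restrict t I)(i := restrict t I j + d) = t"
    proof
      fix t assume "t \<in> ?L"
      then have t: "t \<in> extensional (insert i I)" "t i = t j + d" unfolding L by auto
      show "(restrict t I)(i := restrict t I j + d) = t"
      proof
        fix k show "((restrict t I)(i := restrict t I j + d)) k = t k"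
          using t assms(2) extensional_arb[OF t(1), of k] by (cases "k = i"; cases "k \<in> I") simp_all
      qed
    qed
    show "\<forall>s\<in>?R. restrict (s(i := s j + d)) I = s"
    proof
      fix s assume "s \<in> ?R"
      then have s: "s \<in> extensional I" unfolding R by blast
      show "restrict (s(i := s j + d)) I = s"
      proof
        fix k show "restrict (s(i := s j + d)) I k = s k"
          using assms(1) extensional_arb[OF s, of k] by (cases "k = i"; cases "k \<in> I") simp_all
      qed
    qed
    show "(\<lambda>t. restrict t I) ` ?L \<subseteq> ?R"
    proof (rule image_subsetI)
      fix t assume "t \<in> ?L"
      then have t: "\<forall>k\<in>I. t k \<in> X k n" "t i \<in> X i n" "\<forall>(a, b, e)\<in>C. t a \<noteq> t b + e" "t i = t j + d"
        unfolding L by blast+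
      have "\<forall>(a, b, e)\<in>substitute i j d ` C. restrict t I a \<noteq> restrict t I b + e"
      proof (rule cond[of t "restrict t I", THEN iffD2])
        show "t i = restrict t I j + d" using t(4) assms(2) by simp
      qed (use t(3) in simp_all)
      then show "restrict t I \<in> ?R"
        unfolding R using t(1,2,4) assms(2) by simp
    qed
    show "(\<lambda>s. s(i := s j + d)) ` ?R \<subseteq> ?L"
    proof (rule image_subsetI)
      fix s assume "s \<in> ?R"
      then have s: "s \<in> extensional I" "\<forall>k\<in>I. s k \<in> X k n" "s j + d \<in> X i n"
        "\<forall>(a, b, e)\<in>substitute i j d ` C. s a \<noteq> s b + e"
        unfolding R by blast+
      define t where "t = s(i := s j + d)"
      have ti: "t i = s j + d" and tI: "\<And>k. k \<in> I \<Longrightarrow> t k = s k"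
        using assms(1) by (auto simp: t_def)
      have "t \<in> extensional (insert i I)"
        unfolding extensional_def
      proof (intro CollectI allI impI)
        fix k assume "k \<notin> insert i I"
        then show "t k = undefined" using extensional_arb[OF s(1), of k] by (simp add: t_def)
      qed
      moreover have "\<forall>(a, b, e)\<in>C. t a \<noteq> t b + e"
        using cond[of t s, OF ti tI] s(4) by blast
      ultimately have "t \<in> ?L"
        unfolding L using s(2,3) ti tI assms(2) by simp
      then show "s(i := s j + d) \<in> ?L" by (simp only: t_def)
    qed
  qed
qed

text \<open>An outer induction on the number of variables pays for the elimination of one of them, and an
  inner induction on \<open>C\<close> removes the forbidden differences one by one.\<close>

lemma eventually_poly_card_configs:
  fixes X :: "'i \<Rightarrow> nat \<Rightarrow> (int ^ 'd) set"
  assumes "finite I" "\<And>i. i \<in> I \<Longrightarrow> linear_box_union (X i)"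
    and "finite C" "C \<subseteq> I \<times> I \<times> UNIV"
  shows "eventually_poly (\<lambda>n. of_nat (card (configs I X C n)))"
  using assms
proof (induction "card I" arbitrary: I X C rule: less_induct)
  case less
  have fin: "finite (configs I X C n)" for C n
    unfolding configs_def using less.prems(1,2) linear_box_union_finite
    by (intro finite_subset[OF _ finite_PiE[of I "\<lambda>i. X i n"]]) auto
  show ?case
    using less.prems(3,4)
  proof (induction C rule: finite_induct)
    case empty
    have "eventually_poly (\<lambda>n. \<Prod>i\<in>I. of_nat (card (X i n)))"
      using less.prems by (intro eventually_poly_prod linear_box_union_card) auto
    then show ?case using less.prems(1) by (simp add: configs_def card_PiE)
  next
    case (insert c C)
    obtain i j d where c: "c = (i, j, d)" by (cases c)
    have IH: "eventually_poly (\<lambda>n. of_nat (card (configs I X C n)))"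
      using insert by auto
    let ?D = "\<lambda>n. {t \<in> configs I X C n. t i = t j + d}"
    have split: "configs I X (insert c C) n = configs I X C n - ?D n" for n
      by (auto simp: configs_def c)
    have card: "(of_nat (card (configs I X (insert c C) n)) :: rat) =
        of_nat (card (configs I X C n)) - of_nat (card (?D n))" for n
      unfolding split
      by (subst card_Diff_subset) (use fin in \<open>auto intro: finite_subset intro!: of_nat_diff card_mono\<close>)
    have "eventually_poly (\<lambda>n. of_nat (card (?D n)))"
    \<comment> \<open>For \<open>i = j\<close> the equation holds always or never, depending on whether \<open>d = 0\<close>.\<close>
    proof (cases "i = j")
      case True
      then have "card (?D n) = (if d = 0 then card (configs I X C n) else 0)" for n by simp
      then show ?thesis using IH eventually_poly_const[of 0] by (cases "d = 0") (simp_all only: simp_thms if_True if_False of_nat_0)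
    next
      case False
      let ?I = "I - {i}"
      have ij: "i \<in> I" "j \<in> ?I"
        using insert.prems c False by auto
      have "card (?D n) = card (configs ?I (X(j := \<lambda>n. X j n \<inter> {v. v + d \<in> X i n}))
          (substitute i j d ` C) n)" for n
        using card_configs_eliminate[of i ?I j C X n d] ij insert.prems by (simp add: insert_absorb)
      moreover have "eventually_poly (\<lambda>n. of_nat (card (configs ?I
          (X(j := \<lambda>n. X j n \<inter> {v. v + d \<in> X i n})) (substitute i j d ` C) n)))"
      proof (rule less.hyps)
        show "card ?I < card I" using less.prems(1) ij(1) by (rule card_Diff1_less)
        show "finite ?I" "finite (substitute i j d ` C)" using less.prems(1) insert.hyps by auto
        show "linear_box_union ((X(j := \<lambda>n. X j n \<inter> {v. v + d \<in> X i n})) k)" if "k \<in> ?I" for k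
        proof (cases "k = j")
          case True
          have "linear_box_union (\<lambda>n. X j n \<inter> {v. v + d \<in> X i n})"
            using ij by (intro linear_box_union_Int linear_box_union_translate less.prems(2)) auto
          then show ?thesis using True by simp
        next
          case False
          then show ?thesis using that less.prems(2)[of k] by simp
        qed
        show "substitute i j d ` C \<subseteq> ?I \<times> ?I \<times> UNIV"
          using ij insert.prems by (auto simp: substitute_def split: if_splits)
      qed
      ultimately show ?thesis by simp
    qed
    then show ?case unfolding card using IH by (intro eventually_poly_diff)
  qed
qed

section \<open>Packings as unordered configurations\<close>

text \<open>This is the product of \<open>(count (mset xs) x)!\<close> over all \<open>x \<noteq> e\<close>. The exceptional value \<open>e\<close> will be
  the class of the empty figure: its copies are all placed on the same set \<open>{}\<close>, so permuting them
  changes nothing, whereas copies of a nonempty figure occupy distinct sets.\<close>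

primrec num_listings :: "'b \<Rightarrow> 'b list \<Rightarrow> nat" where
  "num_listings e [] = 1"
| "num_listings e (x # xs) = (if x = e then 1 else count (mset (x # xs)) x) * num_listings e xs"

lemma num_listings_pos: "num_listings e xs > 0"
  by (induction xs) auto

lemma finite_mset_fibre: "finite {ys. mset ys = P}"
proof -
  obtain xs where "P = mset xs" using ex_mset by metis
  then show ?thesis by (simp add: mset_eq_finite)
qed

text \<open>The head of the list can be any member of \<open>P\<close> of the first prescribed class, and the tail lists
  the rest of \<open>P\<close>. Members other than \<open>a\<close> occur once, so the number of choices for the head is the
  multiplicity of that class; if the class is \<open>c a\<close>, the only choice is \<open>a\<close>.\<close>

lemma card_listings:
  assumes "image_mset c P = mset xs"
    and "\<And>A. A \<in># P \<Longrightarrow> A \<noteq> a \<Longrightarrow> count P A \<le> 1"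
    and "\<And>A. A \<in># P \<Longrightarrow> c A = c a \<Longrightarrow> A = a"
  shows "card {ys. mset ys = P \<and> map c ys = xs} = num_listings (c a) xs"
  using assms
proof (induction xs arbitrary: P)
  case Nil
  then have "{ys. mset ys = P \<and> map c ys = []} = {[]}" by auto
  then show ?case by simp
next
  case (Cons x xs)
  define K where "K = {A \<in> set_mset P. c A = x}"
  define L where "L A = {ys. mset ys = P - {#A#} \<and> map c ys = xs}" for A
  have finL: "finite (L A)" for A
    by (rule finite_subset[OF _ finite_mset_fibre[of "P - {#A#}"]]) (auto simp: L_def)
  have "{ys. mset ys = P \<and> map c ys = x # xs} = (\<Union>A\<in>K. (#) A ` L A)"
  proof (intro equalityI subsetI)
    fix ys assume "ys \<in> {ys. mset ys = P \<and> map c ys = x # xs}"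
    then obtain A zs where "ys = A # zs" "c A = x" "map c zs = xs" "P = add_mset A (mset zs)"
      by auto
    then show "ys \<in> (\<Union>A\<in>K. (#) A ` L A)" by (auto simp: K_def L_def)
  qed (auto simp: K_def L_def)
  then have "card {ys. mset ys = P \<and> map c ys = x # xs} = card (\<Union>A\<in>K. (#) A ` L A)"
    by simp
  also have "\<dots> = (\<Sum>A\<in>K. card ((#) A ` L A))"
    using finL by (intro card_UN_disjoint) (auto simp: K_def)
  also have "\<dots> = (\<Sum>A\<in>K. num_listings (c a) xs)"
  proof (rule sum.cong)
    fix A assume A: "A \<in> K"
    have "card ((#) A ` L A) = card (L A)" by (rule card_image) (auto intro: inj_onI)
    also have "\<dots> = num_listings (c a) xs"
      unfolding L_def
    proof (rule Cons.IH)
      show "image_mset c (P - {#A#}) = mset xs"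
        using A Cons.prems(1) by (simp add: K_def image_mset_Diff)
      show "count (P - {#A#}) B \<le> 1" if "B \<in># P - {#A#}" "B \<noteq> a" for B
        using Cons.prems(2)[of B] that in_diffD[OF that(1)] by auto
      show "B = a" if "B \<in># P - {#A#}" "c B = c a" for B
        using Cons.prems(3)[of B] that in_diffD[OF that(1)] by auto
    qed
    finally show "card ((#) A ` L A) = num_listings (c a) xs" .
  qed simp
  also have "\<dots> = card K * num_listings (c a) xs" by simp
  also have "card K = (if x = c a then 1 else count (mset (x # xs)) x)"
  proof (cases "x = c a")
    case True
    have "x \<in># image_mset c P" by (simp add: Cons.prems(1))
    then have "K \<noteq> {}" by (auto simp: K_def)
    moreover have "K \<subseteq> {a}" using Cons.prems(3) True by (auto simp: K_def)
    ultimately have "K = {a}" by auto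
    then show ?thesis using True by simp
  next
    case False
    have "count (mset (x # xs)) x = (\<Sum>A\<in>c -` {x} \<inter> set_mset P. count P A)"
      unfolding Cons.prems(1)[symmetric] by (rule count_image_mset)
    also have "c -` {x} \<inter> set_mset P = K" by (auto simp: K_def)
    also have "(\<Sum>A\<in>K. count P A) = (\<Sum>A\<in>K. 1)"
    proof (rule sum.cong)
      fix A assume "A \<in> K"
      then have "A \<in># P" "A \<noteq> a" using False by (auto simp: K_def)
      then show "count P A = 1"
        using Cons.prems(2)[of A] by (simp add: le_antisym Suc_le_eq)
    qed simp
    finally show ?thesis using False by simp
  qed
  finally show ?case by simp
qed

definition figure_of :: "(int ^ 'd) set \<Rightarrow> (int ^ 'd) set set" where
  "figure_of A = translation_rel `` {A}"

lemma figure_of_eq: "finite A \<Longrightarrow> figure_of A = range (\<lambda>t. (+) t ` A)"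
  by (auto simp: figure_of_def translation_rel_def)

lemma self_in_figure_of: "finite A \<Longrightarrow> A \<in> figure_of A"
  unfolding figure_of_eq by (rule range_eqI[of _ _ 0]) simp

lemma figure_of_empty: "figure_of {} = {{}}"
  by (simp add: figure_of_eq)

lemma figuresE:
  assumes "F \<in> figures"
  obtains A where "finite A" "F = figure_of A"
  using assms unfolding figures_def figure_of_def by (auto elim!: quotientE)

lemma in_figureD:
  assumes "F \<in> figures" "A \<in> F"
  shows "finite A" "figure_of A = F"
proof -
  obtain B where B: "finite B" "F = figure_of B" using assms(1) by (rule figuresE)
  then have rel: "(B, A) \<in> translation_rel" using assms(2) by (simp add: figure_of_def)
  then show "finite A" by (simp add: translation_rel_def)
  show "figure_of A = F"
    unfolding B(2) figure_of_def using equiv_class_eq[OF equiv_translation_rel rel] by simp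
qed

text \<open>The sum of the members of \<open>(+) t ` A\<close> determines \<open>t\<close>, because \<open>\<int>\<^sup>d\<close> is torsion-free.\<close>

lemma translate_inject:
  fixes A :: "(int ^ 'd) set"
  assumes "finite A" "A \<noteq> {}" "(+) s ` A = (+) t ` A"
  shows "s = t"
proof -
  have sum: "(\<Sum>v\<in>(+) x ` A. v $ k) = int (card A) * x $ k + (\<Sum>a\<in>A. a $ k)" for k x
    by (subst sum.reindex) (auto simp: inj_on_def sum.distrib)
  have "int (card A) * s $ k = int (card A) * t $ k" for k
    using sum[of k s] sum[of k t] unfolding assms(3) by linarith
  then show ?thesis using assms(1,2) by (simp add: vec_eq_iff)
qed

lemma pair_subseteq_mset_iff:
  "{#x, y#} \<subseteq># mset ys \<longleftrightarrow> (\<exists>i<length ys. \<exists>j<length ys. i \<noteq> j \<and> ys ! i = x \<and> ys ! j = y)"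
proof -
  have remove: "mset ys = add_mset (ys ! i) (mset (take i ys @ drop (Suc i) ys))"
    and others: "set (take i ys @ drop (Suc i) ys) = {ys ! j | j. j < length ys \<and> j \<noteq> i}"
    if i: "i < length ys" for i
  proof -
    have "mset ys = mset (take i ys @ ys ! i # drop (Suc i) ys)"
      using id_take_nth_drop[OF i] by simp
    then show "mset ys = add_mset (ys ! i) (mset (take i ys @ drop (Suc i) ys))" by simp
    show "set (take i ys @ drop (Suc i) ys) = {ys ! j | j. j < length ys \<and> j \<noteq> i}"
    proof (intro equalityI subsetI)
      fix z assume "z \<in> set (take i ys @ drop (Suc i) ys)"
      then show "z \<in> {ys ! j | j. j < length ys \<and> j \<noteq> i}"
        using i by (fastforce simp: in_set_conv_nth)
    next
      fix z assume "z \<in> {ys ! j | j. j < length ys \<and> j \<noteq> i}"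
      then obtain j where j: "z = ys ! j" "j < length ys" "j < i \<or> i < j"
        using nat_neq_iff by blast
      from j(3) show "z \<in> set (take i ys @ drop (Suc i) ys)"
      proof
        assume "j < i"
        then have "take i ys ! j = z" "j < length (take i ys)" using j by auto
        then show ?thesis by (metis UnI1 nth_mem set_append)
      next
        assume "i < j"
        then have "drop (Suc i) ys ! (j - Suc i) = z" "j - Suc i < length (drop (Suc i) ys)"
          using j i by auto
        then show ?thesis by (metis UnI2 nth_mem set_append)
      qed
    qed
  qed
  show ?thesis
  proof
    assume sub: "{#x, y#} \<subseteq># mset ys"
    then have "x \<in># mset ys" by (meson mset_subset_eqD union_single_eq_member)
    then obtain i where i: "i < length ys" "ys ! i = x" by (auto simp: in_set_conv_nth)
    then have "y \<in># mset (take i ys @ drop (Suc i) ys)"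
      using sub remove[OF i(1)] by simp
    then have "y \<in> {ys ! j | j. j < length ys \<and> j \<noteq> i}"
      using others[OF i(1)] by (simp only: set_mset_mset)
    then show "\<exists>i<length ys. \<exists>j<length ys. i \<noteq> j \<and> ys ! i = x \<and> ys ! j = y"
      using i by auto
  next
    assume "\<exists>i<length ys. \<exists>j<length ys. i \<noteq> j \<and> ys ! i = x \<and> ys ! j = y"
    then obtain i j where ij: "i < length ys" "j < length ys" "i \<noteq> j" "ys ! i = x" "ys ! j = y"
      by auto
    then have "y \<in> {ys ! j | j. j < length ys \<and> j \<noteq> i}" by auto
    then have "y \<in> set (take i ys @ drop (Suc i) ys)" using others[OF ij(1)] by simp
    then have "{#y#} \<subseteq># mset (take i ys @ drop (Suc i) ys)" by simp
    then show "{#x, y#} \<subseteq># mset ys" using remove[OF ij(1)] ij(4) by simp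
  qed
qed

text \<open>Packings in which the figures are placed in the order of the list \<open>Fs\<close>, with copies of the same
  figure told apart by their positions.\<close>

definition labelled_packings :: "(int ^ 'd) set set list \<Rightarrow> (int ^ 'd) graph \<Rightarrow>
    (int ^ 'd) set list set" where
  "labelled_packings Fs G = {ys. list_all2 (\<lambda>F A. A \<in> placements F G) Fs ys \<and>
     (\<forall>i<length ys. \<forall>j<length ys. i \<noteq> j \<longrightarrow> ys ! i \<inter> ys ! j = {})}"

lemma length_labelled_packing: "ys \<in> labelled_packings Fs G \<Longrightarrow> length ys = length Fs"
  unfolding labelled_packings_def by (auto dest: list_all2_lengthD)

lemma disjoint_mset_iff:
  "(\<forall>A B. {#A, B#} \<subseteq># mset ys \<longrightarrow> A \<inter> B = {}) \<longleftrightarrow>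
     (\<forall>i<length ys. \<forall>j<length ys. i \<noteq> j \<longrightarrow> ys ! i \<inter> ys ! j = {})"
  unfolding pair_subseteq_mset_iff by blast

lemma packings_eq_image_labelled: "packings (mset Fs) G = mset ` labelled_packings Fs G"
proof (intro equalityI subsetI)
  fix P assume P: "P \<in> packings (mset Fs) G"
  then obtain xs ys where "mset xs = mset Fs" "mset ys = P"
    "list_all2 (\<lambda>F A. A \<in> placements F G) xs ys"
    by (auto simp: packings_def rel_mset_def)
  then obtain zs where zs: "list_all2 (\<lambda>F A. A \<in> placements F G) Fs zs" "mset zs = P"
    using list_all2_reorder_left_invariance[of _ xs ys Fs] by metis
  moreover have "\<forall>A B. {#A, B#} \<subseteq># mset zs \<longrightarrow> A \<inter> B = {}"
    using P zs(2) by (simp add: packings_def)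
  ultimately show "P \<in> mset ` labelled_packings Fs G"
    unfolding disjoint_mset_iff by (auto simp: labelled_packings_def)
next
  fix P assume "P \<in> mset ` labelled_packings Fs G"
  then obtain ys where "P = mset ys" "list_all2 (\<lambda>F A. A \<in> placements F G) Fs ys"
    "\<forall>A B. {#A, B#} \<subseteq># mset ys \<longrightarrow> A \<inter> B = {}"
    unfolding disjoint_mset_iff by (auto simp: labelled_packings_def)
  then show "P \<in> packings (mset Fs) G"
    by (auto simp: packings_def rel_mset_def)
qed

text \<open>A placed set belongs to only one figure. So the labelled packings with a given underlying
  multiset \<open>P\<close> are the listings of \<open>P\<close> in which the figures of the entries spell out \<open>Fs\<close>, and
  the number of these does not depend on \<open>P\<close>. Nonempty sets cannot repeat in \<open>P\<close>, because a set
  that is disjoint from itself is empty.\<close>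

lemma card_labelled_packings:
  fixes Fs :: "(int ^ 'd) set set list"
  assumes "set Fs \<subseteq> figures" "finite (packings (mset Fs) G)"
  shows "card (labelled_packings Fs G) = card (packings (mset Fs) G) * num_listings {{}} Fs"
proof -
  let ?L = "labelled_packings Fs G" and ?Q = "packings (mset Fs) G"
  have entry: "finite (ys ! i)" "ys ! i \<subseteq> vertices G" "figure_of (ys ! i) = Fs ! i"
    if "ys \<in> ?L" "i < length Fs" for ys i
  proof -
    have F: "Fs ! i \<in> figures" using assms(1) that(2) by auto
    have "ys ! i \<in> placements (Fs ! i) G"
      using that by (auto simp: labelled_packings_def list_all2_conv_all_nth)
    then show "finite (ys ! i)" "ys ! i \<subseteq> vertices G" "figure_of (ys ! i) = Fs ! i"
      using in_figureD[OF F] by (auto simp: placements_def)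
  qed
  have map: "map figure_of ys = Fs" if "ys \<in> ?L" for ys
  proof (rule nth_equalityI)
    show "length (map figure_of ys) = length Fs"
      using length_labelled_packing[OF that] by simp
    then show "map figure_of ys ! i = Fs ! i" if "i < length (map figure_of ys)" for i
      using that entry(3)[OF \<open>ys \<in> ?L\<close>, of i] by simp
  qed
  have member: "finite A" "A \<subseteq> vertices G" if "ys \<in> ?L" "A \<in> set ys" for ys A
  proof -
    obtain i where "i < length ys" "A = ys ! i" using \<open>A \<in> set ys\<close> by (auto simp: in_set_conv_nth)
    moreover have "length ys = length Fs"
      by (rule length_labelled_packing[OF that(1)])
    ultimately show "finite A" "A \<subseteq> vertices G" using entry(1,2)[OF that(1), of i] by auto
  qed
  have fibre: "{ys \<in> ?L. mset ys = P} = {ys. mset ys = P \<and> map figure_of ys = Fs}" if P: "P \<in> ?Q" for P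
  proof (intro equalityI subsetI)
    fix ys assume "ys \<in> {ys. mset ys = P \<and> map figure_of ys = Fs}"
    then have ys: "mset ys = P" "map figure_of ys = Fs" by auto
    obtain zs where zs: "zs \<in> ?L" "mset zs = P"
      using P unfolding packings_eq_image_labelled by blast
    have set: "set ys = set zs" using ys(1) zs(2) by (metis set_mset_mset)
    have "list_all2 (\<lambda>F A. A \<in> placements F G) Fs ys"
      unfolding list_all2_conv_all_nth
    proof (intro conjI allI impI)
      show len: "length Fs = length ys" unfolding ys(2)[symmetric] by simp
      fix i assume i: "i < length Fs"
      then have "ys ! i \<in> set zs" unfolding len set[symmetric] by (rule nth_mem)
      then have "finite (ys ! i)" "ys ! i \<subseteq> vertices G"
        by (simp_all only: member[OF zs(1), of "ys ! i"])
      moreover have "Fs ! i = figure_of (ys ! i)"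
        using i unfolding ys(2)[symmetric] by simp
      ultimately show "ys ! i \<in> placements (Fs ! i) G"
        by (simp add: placements_def self_in_figure_of)
    qed
    moreover have "\<forall>A B. {#A, B#} \<subseteq># mset ys \<longrightarrow> A \<inter> B = {}"
      using that ys(1) by (simp add: packings_def)
    ultimately show "ys \<in> {ys \<in> ?L. mset ys = P}"
      unfolding disjoint_mset_iff using ys(1) by (simp add: labelled_packings_def)
  qed (auto simp: map)
  have fin: "finite {ys \<in> ?L. mset ys = P}" for P
    by (rule finite_subset[OF _ finite_mset_fibre[of P]]) auto
  have "?L = (\<Union>P\<in>?Q. {ys \<in> ?L. mset ys = P})"
    by (auto simp: packings_eq_image_labelled)
  then have "card ?L = card (\<Union>P\<in>?Q. {ys \<in> ?L. mset ys = P})" by simp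
  also have "\<dots> = (\<Sum>P\<in>?Q. card {ys \<in> ?L. mset ys = P})"
    using assms(2) fin by (intro card_UN_disjoint) auto
  also have "\<dots> = (\<Sum>P\<in>?Q. num_listings {{}} Fs)"
  proof (rule sum.cong)
    fix P assume P: "P \<in> ?Q"
    then obtain zs where zs: "zs \<in> ?L" "mset zs = P"
      unfolding packings_eq_image_labelled by blast
    have "card {ys. mset ys = P \<and> map figure_of ys = Fs} = num_listings (figure_of {}) Fs"
    proof (rule card_listings)
      show "image_mset figure_of P = mset Fs"
        using map[OF zs(1)] zs(2) by (metis mset_map)
      show "count P A \<le> 1" if "A \<noteq> {}" for A
      proof (rule ccontr)
        assume "\<not> count P A \<le> 1"
        then have "{#A, A#} \<subseteq># P" by (simp add: subseteq_mset_def)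
        then have "A \<inter> A = {}" using P unfolding packings_def by blast
        then show False using that by simp
      qed
      show "A = {}" if "A \<in># P" "figure_of A = figure_of {}" for A
      proof -
        have "A \<in> set zs" using that(1) unfolding zs(2)[symmetric] by simp
        then have "A \<in> figure_of A" by (intro self_in_figure_of member(1)[OF zs(1)])
        then show ?thesis unfolding that(2) figure_of_empty by simp
      qed
    qed
    then show "card {ys \<in> ?L. mset ys = P} = num_listings {{}} Fs"
      by (simp add: fibre[OF P] figure_of_empty)
  qed simp
  finally show ?thesis by simp
qed

text \<open>Labelled packings correspond to configurations of the nonempty figures: a nonempty finite set has
  different translates under different vectors, while all translates of the empty set
  coincide, so a vector for an empty figure would be counted infinitely often.\<close>

lemma eventually_poly_card_labelled_packings:
  fixes Z :: "(int ^ 'd) set"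
  assumes Z: "finite Z" and Fs: "set Fs \<subseteq> figures"
  shows "eventually_poly (\<lambda>n. of_nat (card (labelled_packings Fs (cell_graph Z n))))"
proof -
  define m where "m = length Fs"
  define V where "V n = vertices (cell_graph Z n)" for n
  have "\<exists>B. finite B \<and> Fs ! i = figure_of B" if "i < m" for i
    using that Fs nth_mem[of i Fs] unfolding m_def by (metis figuresE subsetD)
  then obtain A where A: "\<And>i. i < m \<Longrightarrow> finite (A i)" "\<And>i. i < m \<Longrightarrow> Fs ! i = figure_of (A i)"
    by metis
  \<comment> \<open>A configuration leaves \<open>t i\<close> undefined for \<open>i \<notin> I\<close>, but then \<open>place t ! i\<close> is \<open>{}\<close> for any
    value of \<open>t i\<close>.\<close>
  define I where "I = {i. i < m \<and> A i \<noteq> {}}"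
  define X where "X i n = {t. (+) t ` A i \<subseteq> V n}" for i n
  define C where "C = (\<Union>i\<in>I. \<Union>j\<in>I - {i}. (\<lambda>(a, b). (i, j, b - a)) ` (A i \<times> A j))"
  define place where "place t = map (\<lambda>i. (+) (t i) ` A i) [0..<m]" for t :: "nat \<Rightarrow> int ^ 'd"
  have I: "finite I" "\<And>i. i \<in> I \<Longrightarrow> i < m" "\<And>i. i \<in> I \<Longrightarrow> finite (A i)" "\<And>i. i \<in> I \<Longrightarrow> A i \<noteq> {}"
    using A by (auto simp: I_def)
  have place_nth: "place t ! i = (+) (t i) ` A i" if "i < m" for t i
    using that by (simp add: place_def)
  have place_length: "length (place t) = m" for t by (simp add: place_def)
  have disjoint: "(\<forall>(i, j, d)\<in>C. t i \<noteq> t j + d) \<longleftrightarrow>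
      (\<forall>i<m. \<forall>j<m. i \<noteq> j \<longrightarrow> place t ! i \<inter> place t ! j = {})" for t
  proof -
    have meet: "(+) (t i) ` A i \<inter> (+) (t j) ` A j = {} \<longleftrightarrow>
        (\<forall>a\<in>A i. \<forall>b\<in>A j. t i \<noteq> t j + (b - a))" for i j
    proof -
      have "t i + a = t j + b \<longleftrightarrow> t i = t j + (b - a)" for a b
        by (metis add_diff_cancel_right' add_diff_eq diff_add_cancel)
      then show ?thesis by (auto simp: disjoint_iff)
    qed
    have "(\<forall>(i, j, d)\<in>C. t i \<noteq> t j + d) \<longleftrightarrow>
        (\<forall>i\<in>I. \<forall>j\<in>I. i \<noteq> j \<longrightarrow> (\<forall>a\<in>A i. \<forall>b\<in>A j. t i \<noteq> t j + (b - a)))"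
      unfolding C_def by fastforce
    also have "\<dots> \<longleftrightarrow> (\<forall>i<m. \<forall>j<m. i \<noteq> j \<longrightarrow> (\<forall>a\<in>A i. \<forall>b\<in>A j. t i \<noteq> t j + (b - a)))"
      unfolding I_def by blast
    finally show ?thesis by (simp add: place_nth meet)
  qed
  have "bij_betw place (configs I X C n) (labelled_packings Fs (cell_graph Z n))" for n
    unfolding bij_betw_def
  proof
    show "inj_on place (configs I X C n)"
    proof (rule inj_onI)
      fix s t assume s: "s \<in> configs I X C n" and t: "t \<in> configs I X C n" and eq: "place s = place t"
      have "s i = t i" if "i \<in> I" for i
        using translate_inject[of "A i" "s i" "t i"] I that eq place_nth[of i s] place_nth[of i t] by simp
      moreover have "s \<in> extensional I" "t \<in> extensional I"
        using s t by (auto simp: configs_def PiE_iff)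
      ultimately show "s = t" by (rule extensionalityI[rotated 2])
    qed
    show "place ` configs I X C n = labelled_packings Fs (cell_graph Z n)"
    proof (intro equalityI subsetI)
      fix ys assume "ys \<in> place ` configs I X C n"
      then obtain t where t: "t \<in> configs I X C n" and ys: "ys = place t" by auto
      have "place t ! i \<in> placements (Fs ! i) (cell_graph Z n)" if "i < m" for i
      proof -
        have "(+) (t i) ` A i \<subseteq> V n"
        proof (cases "i \<in> I")
          case True
          then show ?thesis using t by (auto simp: configs_def PiE_iff X_def)
        next
          case False
          then show ?thesis using that by (simp add: I_def)
        qed
        then show ?thesis
          using A[OF that] by (simp add: place_nth[OF that] placements_def V_def figure_of_eq)
      qed
      moreover have "\<forall>i<m. \<forall>j<m. i \<noteq> j \<longrightarrow> place t ! i \<inter> place t ! j = {}"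
        using t disjoint[of t] by (simp add: configs_def)
      ultimately show "ys \<in> labelled_packings Fs (cell_graph Z n)"
        by (simp add: ys labelled_packings_def list_all2_conv_all_nth place_length m_def)
    next
      fix ys assume ys: "ys \<in> labelled_packings Fs (cell_graph Z n)"
      then have len: "length ys = m"
        unfolding m_def by (rule length_labelled_packing)
      have pl: "ys ! i \<in> placements (Fs ! i) (cell_graph Z n)" if "i < m" for i
        using ys that by (simp add: labelled_packings_def list_all2_conv_all_nth m_def)
      have "\<exists>t. ys ! i = (+) t ` A i" if "i < m" for i
        using pl[OF that] A[OF that] by (auto simp: placements_def figure_of_eq)
      then obtain t where t: "\<And>i. i < m \<Longrightarrow> ys ! i = (+) (t i) ` A i" by metis
      have ys_place: "ys = place (restrict t I)"
      proof (rule nth_equalityI)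
        show "ys ! i = place (restrict t I) ! i" if "i < length ys" for i
          using that by (cases "i \<in> I") (auto simp: t place_nth len I_def)
      qed (simp add: len place_length)
      have "restrict t I \<in> configs I X C n"
        unfolding configs_def
      proof (intro CollectI conjI)
        show "restrict t I \<in> PiE I (\<lambda>i. X i n)"
        proof (rule restrict_PiE_iff[THEN iffD2], rule ballI)
          fix i assume "i \<in> I"
          then show "t i \<in> X i n"
            using pl[OF I(2)] t[OF I(2)] by (simp add: X_def V_def placements_def)
        qed
        show "\<forall>(i, j, d)\<in>C. restrict t I i \<noteq> restrict t I j + d"
          unfolding disjoint ys_place[symmetric] using ys by (simp add: labelled_packings_def len)
      qed
      then show "ys \<in> place ` configs I X C n" using ys_place by blast
    qed
  qed
  then have "card (labelled_packings Fs (cell_graph Z n)) = card (configs I X C n)" for n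
    by (rule bij_betw_same_card[symmetric])
  moreover have "eventually_poly (\<lambda>n. of_nat (card (configs I X C n)))"
  proof (rule eventually_poly_card_configs)
    show "finite I" by (rule I)
    show "finite C" unfolding C_def using I by (intro finite_UN_I finite_imageI finite_cartesian_product) auto
    show "C \<subseteq> I \<times> I \<times> UNIV" by (auto simp: C_def)
    fix i assume i: "i \<in> I"
    have "X i = (\<lambda>n. \<Inter>a\<in>A i. {t. t + a \<in> V n})"
      by (auto simp: X_def fun_eq_iff)
    moreover have "linear_box_union (\<lambda>n. \<Inter>a\<in>A i. {t. t + a \<in> V n})"
      unfolding V_def using I(3,4)[OF i]
      by (rule linear_box_union_finite_Int)
        (rule linear_box_union_translate[OF linear_box_union_cell_graph[OF Z]])
    ultimately show "linear_box_union (X i)" by simp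
  qed
  ultimately show ?thesis by simp
qed

theorem theorem5p4:
  fixes Z :: "(int ^ 'd) set"
    and S :: "(int ^ 'd) set set multiset"
  assumes "finite Z"
    and "set_mset S \<subseteq> figures"
  shows "\<exists>n\<^sub>0 :: nat. n\<^sub>0 > 0 \<and>
    (\<exists>p :: rat poly. (\<forall>x :: int. poly p (of_int x) \<in> \<int>) \<and>
      (\<forall>n\<ge>n\<^sub>0. of_nat (num_packings Z S n) = poly p (of_nat n)))"
proof -
  obtain Fs where Fs: "mset Fs = S" using ex_mset by blast
  define c where "c = num_listings {{}} Fs"
  have "c > 0" unfolding c_def by (rule num_listings_pos)
  have set: "set Fs \<subseteq> figures" using assms(2) Fs by auto
  have count: "card (labelled_packings Fs (cell_graph Z n)) = num_packings Z S n * c" for n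
    unfolding c_def num_packings_def Fs[symmetric]
    by (rule card_labelled_packings[OF set finite_packings[OF assms(1)]])
  have "eventually_poly (\<lambda>n. of_nat (num_packings Z S n * c) * (1 / of_nat c))"
    unfolding count[symmetric]
    by (rule eventually_poly_mult[OF eventually_poly_card_labelled_packings[OF assms(1) set]
          eventually_poly_const])
  then have "eventually_poly (\<lambda>n. of_nat (num_packings Z S n))"
    using \<open>c > 0\<close> by simp
  then obtain p :: "rat poly" and N where p: "\<And>n. n \<ge> N \<Longrightarrow> of_nat (num_packings Z S n) = poly p (of_nat n)"
    unfolding eventually_poly_def eventually_sequentially by blast
  have "poly p (of_int x) \<in> \<int>" for x :: int
  proof (rule integer_valued_poly)
    show "poly p (of_nat n) \<in> \<int>" if "n \<ge> N" for n
      unfolding p[OF that, symmetric] by simp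
  qed
  then show ?thesis
    using p by (intro exI[of _ "Suc N"] conjI exI[of _ p]) auto
qed

end
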